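(* Consider training a GCN on $P$ local machines by Parallel SGD with Periodic Averaging (described in the context) for $T$ steps of gradient updates, with learning rate $\eta$ and local step size $K$. Suppose the objectives $\mathcal{L}$ and $\mathcal{L}_p^{\text{local}}$ ($p=1,\dots,P$) are $L$-smooth, $\mathcal{L}$ is bounded below, and the following two assumptions hold for all $\boldsymbol\theta$ and all $p$. (Assumption 1) $\mathbb{E}\big[\|\tilde\nabla\mathcal{L}_p^{\text{local}}(\boldsymbol\theta;\xi)-\mathbb{E}[\tilde\nabla\mathcal{L}_p^{\text{local}}(\boldsymbol\theta;\xi)]\|^2\big]\le\sigma_{\text{var}}^2$ and $\|\mathbb{E}[\tilde\nabla\mathcal{L}_p^{\text{local}}(\boldsymbol\theta;\xi)]-\nabla\mathcal{L}_p^{\text{local}}(\boldsymbol\theta)\|^2\le\sigma_{\text{bias}}^2$. (Assumption 2) $\mathbb{E}\big[\|\tilde\nabla\mathcal{L}_p^{\text{full}}(\boldsymbol\theta;\xi)-\nabla\mathcal{L}_p^{\text{full}}(\boldsymbol\theta)\|^2\big]\le\sigma_{\text{global}}^2$. If $\eta=\frac{\sqrt P}{\sqrt T}$ and $K\le\frac{\sqrt2\,T^{1/4}}{8LP^{3/4}}$, then for any $T\ge L^2P$, $$\frac1T\sum_{t=0}^{T-1}\mathbb{E}\big[\|\nabla\mathcal{L}(\bar{\boldsymbol\theta}^t)\|^2\big]=\mathcal{O}\Big(\frac1{\sqrt{PT}}\Big)+\mathcal{O}\big(\kappa^2+\sigma_{\text{bias}}^2\big),$$ where $\bar{\boldsy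mbol\theta}^t=\frac1P\sum_{p=1}^P\boldsymbol\theta_p^t$.
   Context: Graph and objectives. $\mathcal{G}=(\mathcal{V},\mathcal{E})$ is an undirected graph with $N$ nodes; node $v_i$ has feature vector $\mathbf{x}_i\in\mathbb{R}^d$ and label $\mathbf{y}_i$. For a neighborhood map $\mathcal{N}$ and weights $\boldsymbol\theta=\{\mathbf{W}^{(\ell)}\}_{\ell=1}^{D}$ ($D$ is the number of layers), the GCN output $\mathbf{h}_i^{(D)}$ is given by $\mathbf{h}_i^{(0)}=\mathbf{x}_i$ and $\mathbf{h}_i^{(\ell)}=\sigma\big(\frac1{|\mathcal{N}(v_i)|}\sum_{j\in\mathcal{N}(v_i)}\mathbf{h}_j^{(\ell-1)}\mathbf{W}^{(\ell)}\big)$, with $\sigma$ an activation function; $\phi$ is a loss function. The graph is partitioned into $P$ subgraphs $\mathcal{G}_p=(\mathcal{V}_p,\mathcal{E}_p)$, one per machine, where $\mathcal{N}(v_i)$ denotes neighbors in $\mathcal{G}$ and $\mathcal{N}_p(v_i)$ neighbors in $\mathcal{G}_p$. - Global objective: $\mathcal{L}(\boldsymbol\theta)=\frac1N\sum_{i\in\mathcal{V}}\phi(\mathbf{h}_i^{(D)},\mathbf{y}_i)$ using $\mathcal{N}$. - Local objective: $\mathcal{L}_p^{\text{local}}(\boldsymbol\theta)=\frac1{|\mathcal{V}_p|}\sum_{i\in\mathcal{V}_p}\phi(\mathbf{h}_i^{(D)},\mathbf{y}_i)$ using $\mathcal{N}_p$. - $\mathcal{L}_p^{\text{full}}(\boldsymbol\theta)=\frac1{|\mathcal{V}_p|}\sum_{i\in\mathcal{V}_p}\phi(\mathbf{h}_i^{(D)},\mathbf{y}_i)$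 using $\mathcal{N}$ (and all node features). - $\tilde\nabla\mathcal{L}_p^{\text{local}}(\boldsymbol\theta;\xi)$ is the stochastic gradient computed on a random mini-batch $\xi$ of nodes of $\mathcal{V}_p$ with randomly sampled neighbors; it may be a biased estimator of $\nabla\mathcal{L}_p^{\text{local}}(\boldsymbol\theta)$. $\tilde\nabla\mathcal{L}_p^{\text{full}}(\boldsymbol\theta;\xi)$ is the stochastic gradient on a random mini-batch of $\mathcal{V}_p$ using all neighbors in $\mathcal{G}$. Local-global gradient discrepancy: $\kappa^2=\kappa_{\mathbf{A}}^2+\kappa_{\mathbf{X}}^2$, where $\kappa_{\mathbf{A}}^2=\max_{p}\|\nabla\mathcal{L}_p^{\text{local}}(\boldsymbol\theta)-\nabla\mathcal{L}_p^{\text{full}}(\boldsymbol\theta)\|^2$ and $\kappa_{\mathbf{X}}^2=\max_p\|\nabla\mathcal{L}_p^{\text{full}}(\boldsymbol\theta)-\nabla\mathcal{L}(\boldsymbol\theta)\|^2$, both understood as (finite) uniform bounds over $\boldsymbol\theta$. Smoothness: a differentiable $f$ is $L$-smooth ($L>0$) if $\|\nabla f(\boldsymbol\theta)-\nabla f(\boldsymbol\theta')\|\le L\|\boldsymbol\theta-\boldsymbol\theta'\|$ for all $\boldsymbol\theta,\boldsymbol\theta'$. Algorithm (Parallel SGD with Periodic Averaging). All machines start from the same point: $\boldsymbol\theta_p^0=\bar{\boldsymbol\theta}^0$. At each step $t$, machine $p$ draws a fresh mini-batch $\xi_p^t$, independent across machines and of the past, and performs $\boldsymbol\theta_p^{t+1}=\boldsymbol\theta_p^t-\eta\tilde\nabla\mathcal{L}_p^{\text{local}}(\boldsymbol\theta_p^t;\xi_p^t)$.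 After every $K$ local steps (whenever $K$ divides $t+1$) all local parameters are replaced by their average over the $P$ machines. $\bar{\boldsymbol\theta}^t$ is the average of the $\boldsymbol\theta_p^t$ at every step $t$. Meaning of $\mathcal{O}$: the constant in $\mathcal{O}(1/\sqrt{PT})$ may depend on $L$, $\mathcal{L}(\bar{\boldsymbol\theta}^0)-\inf\mathcal{L}$, $\sigma_{\text{var}}^2$, $\sigma_{\text{bias}}^2$, $\kappa^2$ but not on $P,T,K$; the constant in $\mathcal{O}(\kappa^2+\sigma_{\text{bias}}^2)$ is absolute. *)

theory Defs
  imports "HOL-Probability.Probability"
begin

(* Graphs, layer widths and hence the parameter space are quantified inside the theorem, below the
   constants of the O-terms, so vectors are functions on explicit index sets rather than elements
   of a type of fixed dimension. *)

type_synonym rvec = "nat \<Rightarrow> real"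

(* theta (l, a, b) is the entry in row a and column b of the weight matrix of layer l *)
type_synonym weights = "nat \<times> nat \<times> nat \<Rightarrow> real"

(* Self-loops are permitted, so both conventions for neighbourhoods (with and without the node
   itself) are covered.  width 0 is the feature dimension, width l the output dimension of layer l.
   The machines are 1, ..., machines; part_nodes p and part_edges p form the subgraph of machine p. *)
record gcn =
  nodes :: "nat set"
  edges :: "(nat \<times> nat) set"
  feature :: "nat \<Rightarrow> rvec"
  label :: "nat \<Rightarrow> rvec"
  depth :: nat
  width :: "nat \<Rightarrow> nat"
  activation :: "real \<Rightarrow> real"
  loss :: "rvec \<Rightarrow> rvec \<Rightarrow> real"
  machines :: nat
  part_nodes :: "nat \<Rightarrow> nat set"
  part_edges :: "nat \<Rightarrow> (nat \<times> nat) set"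

definition partitioned_graph :: "gcn \<Rightarrow> bool" where
  "partitioned_graph G \<longleftrightarrow>
     finite (nodes G) \<and> nodes G \<noteq> {} \<and> edges G \<subseteq> nodes G \<times> nodes G \<and> sym (edges G) \<and>
     machines G \<ge> 1 \<and>
     (\<Union>p\<in>{1..machines G}. part_nodes G p) = nodes G \<and>
     disjoint_family_on (part_nodes G) {1..machines G} \<and>
     (\<forall>p\<in>{1..machines G}. part_nodes G p \<noteq> {} \<and>
        part_edges G p \<subseteq> edges G \<inter> part_nodes G p \<times> part_nodes G p \<and> sym (part_edges G p))"

definition neighbors :: "(nat \<times> nat) set \<Rightarrow> nat \<Rightarrow> nat set" where
  "neighbors E v = {u. (v, u) \<in> E}"

(* nb l i is the neighbourhood of node i used in layer l; only sampled neighbourhoods depend on l.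
   Over an empty neighbourhood the mean is 0.  Entries beyond the width of a layer are 0, so the
   loss function depends only on the actual output of the last layer. *)
primrec hidden :: "gcn \<Rightarrow> (nat \<Rightarrow> nat \<Rightarrow> nat set) \<Rightarrow> weights \<Rightarrow> nat \<Rightarrow> nat \<Rightarrow> rvec" where
  "hidden G nb \<theta> 0 i = (\<lambda>b. if b < width G 0 then feature G i b else 0)"
| "hidden G nb \<theta> (Suc l) i = (\<lambda>b. if b < width G (Suc l)
     then activation G (1 / real (card (nb (Suc l) i)) *
            (\<Sum>j\<in>nb (Suc l) i. \<Sum>a<width G l. hidden G nb \<theta> l j a * \<theta> (Suc l, a, b)))
     else 0)"

definition mean_loss :: "gcn \<Rightarrow> (nat \<Rightarrow> nat \<Rightarrow> nat set) \<Rightarrow> nat set \<Rightarrow> weights \<Rightarrow> real" where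
  "mean_loss G nb B \<theta> =
     1 / real (card B) * (\<Sum>i\<in>B. loss G (hidden G nb \<theta> (depth G) i) (label G i))"

definition global_loss :: "gcn \<Rightarrow> weights \<Rightarrow> real" where
  "global_loss G = mean_loss G (\<lambda>_. neighbors (edges G)) (nodes G)"

definition local_loss :: "gcn \<Rightarrow> nat \<Rightarrow> weights \<Rightarrow> real" where
  "local_loss G p = mean_loss G (\<lambda>_. neighbors (part_edges G p)) (part_nodes G p)"

definition full_loss :: "gcn \<Rightarrow> nat \<Rightarrow> weights \<Rightarrow> real" where
  "full_loss G p = mean_loss G (\<lambda>_. neighbors (edges G)) (part_nodes G p)"

definition params :: "gcn \<Rightarrow> (nat \<times> nat \<times> nat) set" where
  "params G = {(l, a, b). 1 \<le> l \<and> l \<le> depth G \<and> a < width G (l - 1) \<and> b < width G l}"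

(* Euclidean norm of the parameter space; all loss functions above ignore entries of theta
   outside params G. *)
abbreviation pnorm :: "gcn \<Rightarrow> weights \<Rightarrow> real" where
  "pnorm G v \<equiv> L2_set v (params G)"

(* vector of partial derivatives *)
definition grad :: "(weights \<Rightarrow> real) \<Rightarrow> weights \<Rightarrow> weights" where
  "grad f \<theta> = (\<lambda>k. deriv (\<lambda>s. f (\<theta>(k := s))) (\<theta> k))"

(* Frechet differentiability; the derivative, if there is one, is represented by grad f theta *)
definition differentiable_params :: "gcn \<Rightarrow> (weights \<Rightarrow> real) \<Rightarrow> weights \<Rightarrow> bool" where
  "differentiable_params G f \<theta> \<longleftrightarrow>
     (\<forall>\<epsilon>>0. \<exists>\<delta>>0. \<forall>h. pnorm G h < \<delta> \<longrightarrow>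
        \<bar>f (\<lambda>k. \<theta> k + h k) - f \<theta> - (\<Sum>k\<in>params G. grad f \<theta> k * h k)\<bar> \<le> \<epsilon> * pnorm G h)"

definition smooth :: "gcn \<Rightarrow> real \<Rightarrow> (weights \<Rightarrow> real) \<Rightarrow> bool" where
  "smooth G L f \<longleftrightarrow> (\<forall>\<theta>. differentiable_params G f \<theta>) \<and>
     (\<forall>\<theta> \<theta>'. pnorm G (grad f \<theta> - grad f \<theta>') \<le> L * pnorm G (\<theta> - \<theta>'))"

definition discrepancy_A :: "gcn \<Rightarrow> nat \<Rightarrow> weights \<Rightarrow> real" where
  "discrepancy_A G p \<theta> = (pnorm G (grad (local_loss G p) \<theta> - grad (full_loss G p) \<theta>))\<^sup>2"

definition discrepancy_X :: "gcn \<Rightarrow> nat \<Rightarrow> weights \<Rightarrow> real" where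
  "discrepancy_X G p \<theta> = (pnorm G (grad (full_loss G p) \<theta> - grad (global_loss G) \<theta>))\<^sup>2"

definition finite_discrepancy :: "gcn \<Rightarrow> bool" where
  "finite_discrepancy G \<longleftrightarrow> (\<forall>p\<in>{1..machines G}.
     bdd_above (range (discrepancy_A G p)) \<and> bdd_above (range (discrepancy_X G p)))"

definition kappa_sq :: "gcn \<Rightarrow> real" where
  "kappa_sq G = (MAX p\<in>{1..machines G}. SUP \<theta>. discrepancy_A G p \<theta>) +
                (MAX p\<in>{1..machines G}. SUP \<theta>. discrepancy_X G p \<theta>)"

(* A mini-batch of nodes with, for each layer, a sampled neighbourhood of every node *)
type_synonym sample = "nat set \<times> (nat \<Rightarrow> nat \<Rightarrow> nat set)"

definition batches :: "gcn \<Rightarrow> nat \<Rightarrow> nat set set" where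
  "batches G p = {B. B \<noteq> {} \<and> B \<subseteq> part_nodes G p}"

definition samples :: "gcn \<Rightarrow> nat \<Rightarrow> sample set" where
  "samples G p =
     batches G p \<times> ({1..depth G} \<rightarrow>\<^sub>E {m. \<forall>v. m v \<subseteq> neighbors (part_edges G p) v})"

definition sgrad_local :: "gcn \<Rightarrow> weights \<Rightarrow> sample \<Rightarrow> weights" where
  "sgrad_local G \<theta> \<xi> = grad (mean_loss G (snd \<xi>) (fst \<xi>)) \<theta>"

definition sgrad_full :: "gcn \<Rightarrow> weights \<Rightarrow> nat set \<Rightarrow> weights" where
  "sgrad_full G \<theta> B = grad (mean_loss G (\<lambda>_. neighbors (edges G)) B) \<theta>"

definition mean_sgrad_local :: "gcn \<Rightarrow> sample pmf \<Rightarrow> weights \<Rightarrow> weights" where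
  "mean_sgrad_local G Q \<theta> = (\<lambda>k. measure_pmf.expectation Q (\<lambda>\<xi>. sgrad_local G \<theta> \<xi> k))"

(* \<omega> (p, t) is the sample drawn by machine p in step t *)
primrec local_params ::
  "gcn \<Rightarrow> weights \<Rightarrow> real \<Rightarrow> nat \<Rightarrow> (nat \<times> nat \<Rightarrow> sample) \<Rightarrow> nat \<Rightarrow> nat \<Rightarrow> weights" where
  "local_params G \<theta>0 \<eta> K \<omega> 0 p = \<theta>0"
| "local_params G \<theta>0 \<eta> K \<omega> (Suc t) p =
     (let step = (\<lambda>q. let \<theta> = local_params G \<theta>0 \<eta> K \<omega> t q
                      in (\<lambda>k. \<theta> k - \<eta> * sgrad_local G \<theta> (\<omega> (q, t)) k))
      in if K dvd Suc t
         then (\<lambda>k. 1 / real (machines G) * (\<Sum>q=1..machines G. step q k))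
         else step p)"

definition avg_params ::
  "gcn \<Rightarrow> weights \<Rightarrow> real \<Rightarrow> nat \<Rightarrow> (nat \<times> nat \<Rightarrow> sample) \<Rightarrow> nat \<Rightarrow> weights" where
  "avg_params G \<theta>0 \<eta> K \<omega> t =
     (\<lambda>k. 1 / real (machines G) * (\<Sum>p=1..machines G. local_params G \<theta>0 \<eta> K \<omega> t p k))"

(* Joint law of all draws in T steps: independent over machines and steps *)
definition draws :: "gcn \<Rightarrow> (nat \<Rightarrow> sample pmf) \<Rightarrow> nat \<Rightarrow> (nat \<times> nat \<Rightarrow> sample) pmf" where
  "draws G Q T = Pi_pmf ({1..machines G} \<times> {..<T}) undefined (\<lambda>(p, t). Q p)"

end

theory Submission
  imports Defs
begin

text \<open>
  Let \<^emph>\<open>spread\<close> be the mean squared distance of the local parameters to their average.  Each local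
  mean gradient differs from the global gradient at the average by at most
  \<open>3 (L\<^sup>2 spread + 2 \<kappa>\<^sup>2 + \<sigma>_bias\<^sup>2)\<close> in mean square.  The average itself performs a gradient step whose
  noise has variance at most \<open>\<sigma>_var\<^sup>2 / P\<close> by independence of the machines, and the descent
  inequality of an \<open>L\<close>-smooth function with \<open>\<eta> L \<le> 1\<close> bounds the expected decrease of the objective.
  Between two averagings at most \<open>K\<close> steps are made, so by Cauchy-Schwarz the expected spread is
  bounded by \<open>\<eta>\<^sup>2 K\<close> times the sum of the local errors since the last averaging, which in turn contain
  earlier spreads; as \<open>\<eta>\<^sup>2 K\<^sup>2 L\<^sup>2 \<le> 1 / (32 \<surd>(P T)) \<le> 1 / 32\<close>, strong induction on time closes this
  recursion and yields a spread of order \<open>1 / \<surd>(P T)\<close>.  Telescoping the descent inequality finishes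
  the proof.  All sample spaces are finite, hence integrability is automatic.
\<close>

section \<open>Finitely supported product measures\<close>

text \<open>Fubini for real functions of arbitrary sign: finite supports reduce both sides to finite
  sums.\<close>

lemma expectation_pair_pmf_finite:
  fixes f :: "'a \<times> 'b \<Rightarrow> real"
  assumes "finite (set_pmf p)" "finite (set_pmf q)"
  shows "measure_pmf.expectation (pair_pmf p q) f =
    measure_pmf.expectation p (\<lambda>x. measure_pmf.expectation q (\<lambda>y. f (x, y)))"
proof -
  have "measure_pmf.expectation (pair_pmf p q) f =
      (\<Sum>z\<in>set_pmf p \<times> set_pmf q. f z * pmf (pair_pmf p q) z)"
    using assms by (intro integral_measure_pmf_real) auto
  also have "\<dots> = (\<Sum>x\<in>set_pmf p. (\<Sum>y\<in>set_pmf q. f (x, y) * pmf q y) * pmf p x)"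
    by (simp add: sum.cartesian_product' pmf_pair sum_distrib_right sum_distrib_left mult_ac)
  also have "\<dots> = measure_pmf.expectation p (\<lambda>x. measure_pmf.expectation q (\<lambda>y. f (x, y)))"
    using assms by (simp add: integral_measure_pmf_real[of "set_pmf _"])
  finally show ?thesis .
qed

lemma expectation_mono_finite:
  fixes f g :: "'a \<Rightarrow> real"
  assumes "finite (set_pmf p)" "\<And>x. x \<in> set_pmf p \<Longrightarrow> f x \<le> g x"
  shows "measure_pmf.expectation p f \<le> measure_pmf.expectation p g"
  using assms by (intro integral_mono_AE integrable_measure_pmf_finite AE_pmfI) auto

lemma expectation_cong_pmf:
  fixes f g :: "'a \<Rightarrow> real"
  assumes "\<And>x. x \<in> set_pmf p \<Longrightarrow> f x = g x"
  shows "measure_pmf.expectation p f = measure_pmf.expectation p g"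
  using assms by (intro integral_cong_AE AE_pmfI) auto

lemma finite_set_Pi_pmf:
  assumes "finite I" "\<And>i. i \<in> I \<Longrightarrow> finite (set_pmf (q i))"
  shows "finite (set_pmf (Pi_pmf I d q))"
  using assms by (subst set_Pi_pmf) (auto intro!: finite_PiE_dflt)

lemma expectation_Pi_pmf_component:
  fixes h :: "'b \<Rightarrow> real"
  assumes "finite I" "i \<in> I"
  shows "measure_pmf.expectation (Pi_pmf I d q) (\<lambda>g. h (g i)) = measure_pmf.expectation (q i) h"
proof -
  have "measure_pmf.expectation (map_pmf (\<lambda>g. g i) (Pi_pmf I d q)) h =
      measure_pmf.expectation (q i) h"
    using assms by (simp add: Pi_pmf_component)
  then show ?thesis by simp
qed

text \<open>Bias-variance decomposition: with \<open>m\<close> the mean of \<open>h\<close>, the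
  cross term in the square of \<open>(c + m) + (h x - m)\<close> has mean zero.\<close>

lemma expectation_square_decomposition:
  fixes h :: "'a \<Rightarrow> real"
  assumes "finite (set_pmf p)"
  shows "measure_pmf.expectation p (\<lambda>x. (c + h x)\<^sup>2) = (c + measure_pmf.expectation p h)\<^sup>2 +
    measure_pmf.expectation p (\<lambda>x. (h x - measure_pmf.expectation p h)\<^sup>2)"
proof -
  define m where "m = measure_pmf.expectation p h"
  have int: "integrable (measure_pmf p) u" for u :: "'a \<Rightarrow> real"
    using assms by (rule integrable_measure_pmf_finite)
  have "measure_pmf.expectation p (\<lambda>x. (c + h x)\<^sup>2) =
      measure_pmf.expectation p (\<lambda>x. (c + m)\<^sup>2 + (2 * (c + m) * (h x - m) + (h x - m)\<^sup>2))"
    by (intro Bochner_Integration.integral_cong) (auto simp: power2_eq_square algebra_simps)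
  also have "\<dots> = (c + m)\<^sup>2 + (2 * (c + m) * (measure_pmf.expectation p h - m)
      + measure_pmf.expectation p (\<lambda>x. (h x - m)\<^sup>2))"
    by (simp add: int)
  finally show ?thesis by (simp add: m_def)
qed

text \<open>Variances of independent terms add. The offset \<open>c\<close> is arbitrary so that the
  induction can absorb the value of a split-off component into it.\<close>

lemma expectation_square_sum_Pi_pmf:
  fixes h :: "'i \<Rightarrow> 'b \<Rightarrow> real"
  assumes "finite I" "\<And>i. i \<in> I \<Longrightarrow> finite (set_pmf (q i))"
  shows "measure_pmf.expectation (Pi_pmf I d q) (\<lambda>g. (c + (\<Sum>i\<in>I. h i (g i)))\<^sup>2) =
    (c + (\<Sum>i\<in>I. measure_pmf.expectation (q i) (h i)))\<^sup>2 +
    (\<Sum>i\<in>I. measure_pmf.expectation (q i) (\<lambda>x. (h i x - measure_pmf.expectation (q i) (h i))\<^sup>2))"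
  using assms
proof (induction I arbitrary: c rule: finite_induct)
  case empty
  then show ?case by simp
next
  case (insert i I)
  define m where "m j = measure_pmf.expectation (q j) (h j)" for j
  define v where "v j = measure_pmf.expectation (q j) (\<lambda>x. (h j x - m j)\<^sup>2)" for j
  have fin: "finite (set_pmf (q i))" "finite (set_pmf (Pi_pmf I d q))"
    using insert.prems insert.hyps by (auto intro: finite_set_Pi_pmf)
  have upd: "(\<Sum>j\<in>insert i I. h j ((g(i := y)) j)) = h i y + (\<Sum>j\<in>I. h j (g j))" for g y
    using insert.hyps by (auto intro!: sum.cong)
  have "measure_pmf.expectation (Pi_pmf (insert i I) d q)
          (\<lambda>g. (c + (\<Sum>j\<in>insert i I. h j (g j)))\<^sup>2) =
      measure_pmf.expectation (q i) (\<lambda>y. measure_pmf.expectation (Pi_pmf I d q)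
          (\<lambda>g. ((c + h i y) + (\<Sum>j\<in>I. h j (g j)))\<^sup>2))"
    unfolding Pi_pmf_insert[OF insert.hyps] integral_map_pmf case_prod_beta
      expectation_pair_pmf_finite[OF fin] fst_conv snd_conv upd by (simp only: add.assoc)
  \<comment> \<open>Induction hypothesis with offset \<open>c + h i y\<close>: its variance part
    does not depend on \<open>y\<close>, which leaves the square of a function of one
    component.\<close>
  also have "\<dots> = measure_pmf.expectation (q i)
      (\<lambda>y. ((c + (\<Sum>j\<in>I. m j)) + h i y)\<^sup>2 + (\<Sum>j\<in>I. v j))"
    by (subst insert.IH) (use insert.prems in \<open>auto simp: m_def v_def algebra_simps\<close>)
  also have "\<dots> = ((c + (\<Sum>j\<in>I. m j)) + m i)\<^sup>2 + v i + (\<Sum>j\<in>I. v j)"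
    by (simp add: integrable_measure_pmf_finite fin expectation_square_decomposition m_def v_def)
  finally show ?case
    using insert.hyps by (simp add: m_def v_def algebra_simps)
qed

text \<open>Redrawing the components in \<^term>\<open>J\<close> leaves the joint law unchanged; this replaces
  conditioning on the past.\<close>

lemma expectation_Pi_pmf_resample:
  fixes f :: "('i \<Rightarrow> 'b) \<Rightarrow> real"
  assumes "finite I" "J \<subseteq> I" "\<And>i. i \<in> I \<Longrightarrow> finite (set_pmf (q i))"
  shows "measure_pmf.expectation (Pi_pmf I d q) f =
    measure_pmf.expectation (Pi_pmf I d q) (\<lambda>\<omega>.
      measure_pmf.expectation (Pi_pmf J d q) (\<lambda>g. f (\<lambda>i. if i \<in> J then g i else \<omega> i)))"
proof -
  let ?m = "\<lambda>\<omega> g i. if i \<in> J then g i else \<omega> i"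
  have fin: "finite (set_pmf (Pi_pmf I d q))" "finite (set_pmf (Pi_pmf J d q))"
    using assms by (auto intro!: finite_set_Pi_pmf intro: finite_subset)
  have "finite J" using assms finite_subset by blast
  have "Pi_pmf I d q = Pi_pmf ((I - J) \<union> J) d q" using assms by (simp add: Un_absorb2)
  also have "\<dots> = map_pmf (\<lambda>(\<omega>, g) i. if i \<in> I - J then \<omega> i else g i)
      (pair_pmf (Pi_pmf (I - J) d q) (Pi_pmf J d q))"
    using assms \<open>finite J\<close> by (subst Pi_pmf_union) auto
  \<comment> \<open>The law on \<open>I - J\<close> is written as an image of the full law, so that
    the outer variable ranges over complete families \<open>\<omega>\<close>.\<close>
  also have "Pi_pmf (I - J) d q = map_pmf (\<lambda>\<omega> i. if i \<in> I - J then \<omega> i else d) (Pi_pmf I d q)"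
    using assms by (intro Pi_pmf_subset) auto
  finally have resample: "Pi_pmf I d q = map_pmf (\<lambda>(\<omega>, g) i. if i \<in> I - J then \<omega> i else g i)
      (pair_pmf (map_pmf (\<lambda>\<omega> i. if i \<in> I - J then \<omega> i else d) (Pi_pmf I d q)) (Pi_pmf J d q))" .
  have "measure_pmf.expectation (Pi_pmf I d q) f = measure_pmf.expectation (Pi_pmf I d q)
      (\<lambda>\<omega>. measure_pmf.expectation (Pi_pmf J d q)
        (\<lambda>g. f (\<lambda>i. if i \<in> I - J then if i \<in> I - J then \<omega> i else d else g i)))"
    by (subst resample) (simp only: integral_map_pmf expectation_pair_pmf_finite fin set_map_pmf finite_imageI
        case_prod_conv)
  also have "\<dots> = measure_pmf.expectation (Pi_pmf I d q) (\<lambda>\<omega>.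
      measure_pmf.expectation (Pi_pmf J d q) (\<lambda>g. f (?m \<omega> g)))"
  \<comment> \<open>Outside \<open>I\<close> the left family takes its values from \<open>g\<close>
    and the right one from \<open>\<omega>\<close>; on the supports both equal the default
    \<open>d\<close>.\<close>
  proof (intro expectation_cong_pmf arg_cong[where f = f] ext)
    fix \<omega> g i
    assume "\<omega> \<in> set_pmf (Pi_pmf I d q)" "g \<in> set_pmf (Pi_pmf J d q)"
    then have "i \<notin> I \<Longrightarrow> \<omega> i = d" "i \<notin> J \<Longrightarrow> g i = d"
      using set_Pi_pmf_subset[OF \<open>finite I\<close>, of d q] set_Pi_pmf_subset[OF \<open>finite J\<close>, of d q] by auto
    then show "(if i \<in> I - J then if i \<in> I - J then \<omega> i else d else g i) = ?m \<omega> g i"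
      using assms(2) by auto
  qed
  finally show ?thesis .
qed

section \<open>Smooth functions of the parameters\<close>

lemma L2_set_power2: "(L2_set v S)\<^sup>2 = (\<Sum>k\<in>S. (v k)\<^sup>2)"
  by (simp add: L2_set_def sum_nonneg)

lemma L2_set_scale: "L2_set (\<lambda>k. c * v k) S = \<bar>c\<bar> * L2_set v S"
  unfolding L2_set_def
  by (simp add: power_mult_distrib sum_distrib_left[symmetric] real_sqrt_mult)

lemma inner_le_L2_set: "(\<Sum>k\<in>S. u k * v k) \<le> L2_set u S * L2_set v S"
  by (rule order.trans[OF _ L2_set_mult_ineq]) (auto intro!: sum_mono simp flip: abs_mult)

lemma square_mean_le:
  fixes a :: "'i \<Rightarrow> real"
  assumes "finite I" "I \<noteq> {}"
  shows "(1 / real (card I) * (\<Sum>i\<in>I. a i))\<^sup>2 \<le> 1 / real (card I) * (\<Sum>i\<in>I. (a i)\<^sup>2)"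
proof -
  have "card I > 0" using assms by (simp add: card_gt_0_iff)
  then show ?thesis
    using sum_squared_le_sum_of_squares[of a I] by (simp add: field_simps power2_eq_square)
qed

text \<open>The mean minimises the sum of squared distances: replacing it by \<open>y\<close> adds
  exactly \<open>card I\<close> times the squared shift.\<close>

lemma sum_square_deviation_le:
  fixes a :: "'i \<Rightarrow> real"
  assumes "finite I" "I \<noteq> {}"
  shows "(\<Sum>i\<in>I. (a i - 1 / real (card I) * (\<Sum>j\<in>I. a j))\<^sup>2) \<le> (\<Sum>i\<in>I. (a i - y)\<^sup>2)"
proof -
  define m where "m = 1 / real (card I) * (\<Sum>j\<in>I. a j)"
  have m: "(\<Sum>i\<in>I. a i) = real (card I) * m"
    using assms by (simp add: m_def card_gt_0_iff)
  have "(\<Sum>i\<in>I. (a i - y)\<^sup>2) =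
      (\<Sum>i\<in>I. (a i - m)\<^sup>2 + (m - y) * (2 * a i - m - y))"
    by (intro sum.cong) (auto simp: power2_eq_square algebra_simps)
  also have "\<dots> = (\<Sum>i\<in>I. (a i - m)\<^sup>2) + real (card I) * (m - y)\<^sup>2"
  proof -
    have "(\<Sum>i\<in>I. (m - y) * (2 * a i - m - y)) = (m - y) * (\<Sum>i\<in>I. 2 * a i - m - y)"
      by (simp only: sum_distrib_left)
    also have "(\<Sum>i\<in>I. 2 * a i - m - y) = 2 * (\<Sum>i\<in>I. a i) - real (card I) * m - real (card I) * y"
      by (simp only: sum_subtractf sum_constant sum_distrib_left[symmetric])
    also have "(m - y) * \<dots> = real (card I) * (m - y)\<^sup>2"
      unfolding m by (simp add: power2_eq_square algebra_simps)
    finally show ?thesis by (simp only: sum.distrib)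
  qed
  finally show ?thesis by (simp add: m_def)
qed

lemma square_add3_le: "(a + b + c :: real)\<^sup>2 \<le> 3 * (a\<^sup>2 + b\<^sup>2 + c\<^sup>2)"
proof -
  have "0 \<le> (a - b)\<^sup>2 + (b - c)\<^sup>2 + (c - a)\<^sup>2" by simp
  then show ?thesis by (simp add: power2_eq_square algebra_simps)
qed

lemma L2_set_power2_triangle3:
  "(L2_set (u - z) S)\<^sup>2 \<le>
    3 * ((L2_set (u - v) S)\<^sup>2 + (L2_set (v - w) S)\<^sup>2 + (L2_set (w - z) S)\<^sup>2)"
proof -
  have "(u k - z k)\<^sup>2 \<le> 3 * ((u k - v k)\<^sup>2 + (v k - w k)\<^sup>2 + (w k - z k)\<^sup>2)" for k
    using square_add3_le[of "u k - v k" "v k - w k" "w k - z k"] by simp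
  then have "(\<Sum>k\<in>S. (u k - z k)\<^sup>2) \<le>
      (\<Sum>k\<in>S. 3 * ((u k - v k)\<^sup>2 + (v k - w k)\<^sup>2 + (w k - z k)\<^sup>2))"
    by (intro sum_mono)
  also have "\<dots> = 3 * ((\<Sum>k\<in>S. (u k - v k)\<^sup>2) + (\<Sum>k\<in>S. (v k - w k)\<^sup>2) + (\<Sum>k\<in>S. (w k - z k)\<^sup>2))"
    by (simp add: sum.distrib sum_distrib_left)
  finally show ?thesis by (simp add: L2_set_power2)
qed

lemma L2_set_power2_mean_le:
  assumes "finite I" "I \<noteq> {}"
  shows "(L2_set (\<lambda>k. 1 / real (card I) * (\<Sum>i\<in>I. u i k)) S)\<^sup>2 \<le>
    1 / real (card I) * (\<Sum>i\<in>I. (L2_set (u i) S)\<^sup>2)"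
proof -
  have "(\<Sum>k\<in>S. (1 / real (card I) * (\<Sum>i\<in>I. u i k))\<^sup>2) \<le>
      (\<Sum>k\<in>S. 1 / real (card I) * (\<Sum>i\<in>I. (u i k)\<^sup>2))"
    by (intro sum_mono square_mean_le assms)
  also have "\<dots> = 1 / real (card I) * (\<Sum>i\<in>I. \<Sum>k\<in>S. (u i k)\<^sup>2)"
    by (subst sum.swap) (simp add: sum_distrib_left)
  finally show ?thesis by (simp add: L2_set_power2)
qed

section \<open>Differentiation along lines and the descent inequality\<close>

lemma has_real_derivative_along_line:
  assumes "differentiable_params G f (\<lambda>k. \<theta> k + s * h k)"
  shows "((\<lambda>s. f (\<lambda>k. \<theta> k + s * h k)) has_real_derivative
    (\<Sum>k\<in>params G. grad f (\<lambda>k. \<theta> k + s * h k) k * h k)) (at s)"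
    (is "(?\<phi> has_real_derivative ?D) _")
  unfolding has_field_derivative_def has_derivative_at_alt
proof (intro conjI allI impI)
  fix e :: real
  assume "e > 0"
  \<comment> \<open>Adding 1 keeps \<open>n\<close> positive even when \<open>h\<close> vanishes on
    \<open>params G\<close>; tolerance and radius are both divided by \<open>n\<close>.\<close>
  define n where "n = pnorm G h + 1"
  have n: "n > 0" "pnorm G h \<le> n" by (simp_all add: n_def add_nonneg_pos)
  let ?x = "\<lambda>k. \<theta> k + s * h k"
  obtain \<delta> where "\<delta> > 0" and \<delta>: "\<And>u. pnorm G u < \<delta> \<Longrightarrow>
      \<bar>f (\<lambda>k. ?x k + u k) - f ?x - (\<Sum>k\<in>params G. grad f ?x k * u k)\<bar> \<le> e / n * pnorm G u"
    using assms divide_pos_pos[OF \<open>e > 0\<close> n(1)] unfolding differentiable_params_def by blast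
  show "\<exists>d>0. \<forall>y. norm (y - s) < d \<longrightarrow>
      norm (?\<phi> y - ?\<phi> s - ?D * (y - s)) \<le> e * norm (y - s)"
  proof (intro exI[of _ "\<delta> / n"] conjI allI impI)
    fix y
    assume y: "norm (y - s) < \<delta> / n"
    let ?u = "\<lambda>k. (y - s) * h k"
    have "pnorm G ?u \<le> \<bar>y - s\<bar> * n"
      using n by (simp add: L2_set_scale mult_left_mono)
    moreover have "\<bar>y - s\<bar> * n < \<delta>" using y n by (simp add: field_simps)
    ultimately have "\<bar>f (\<lambda>k. ?x k + ?u k) - f ?x - (\<Sum>k\<in>params G. grad f ?x k * ?u k)\<bar>
        \<le> e / n * (\<bar>y - s\<bar> * n)"
      using \<open>e > 0\<close> n by (intro order.trans[OF \<delta>] mult_left_mono) auto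
    moreover have "(\<lambda>k. ?x k + ?u k) = (\<lambda>k. \<theta> k + y * h k)"
      by (simp add: algebra_simps)
    moreover have "(\<Sum>k\<in>params G. grad f ?x k * ?u k) = ?D * (y - s)"
      by (simp add: sum_distrib_left mult_ac)
    ultimately show "norm (?\<phi> y - ?\<phi> s - ?D * (y - s)) \<le> e * norm (y - s)"
      using n by simp
  qed (use \<open>\<delta> > 0\<close> n in auto)
qed (rule bounded_linear_mult_right)

text \<open>The Lipschitz gradient bounds the slope of \<open>f\<close> along the segment by that of
  a quadratic. The difference \<open>\<psi>\<close> is therefore nonincreasing on the unit interval,
  and its end values give the inequality.\<close>

lemma smooth_descent:
  assumes "smooth G L f"
  shows "f (\<lambda>k. \<theta> k + h k) \<le>
    f \<theta> + (\<Sum>k\<in>params G. grad f \<theta> k * h k) + L / 2 * (pnorm G h)\<^sup>2"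
proof -
  let ?x = "\<lambda>s k. \<theta> k + s * h k"
  let ?D = "\<lambda>s. \<Sum>k\<in>params G. grad f (?x s) k * h k"
  define \<psi> where "\<psi> s = f (?x s) - (s * ?D 0 + L / 2 * s\<^sup>2 * (pnorm G h)\<^sup>2)" for s
  have "((\<lambda>s. s * d + L / 2 * s\<^sup>2 * n) has_real_derivative (d + L * s * n)) (at s)" for d n s :: real
    by (auto intro!: derivative_eq_intros)
  moreover have "((\<lambda>s. f (?x s)) has_real_derivative ?D s) (at s)" for s
    using assms by (intro has_real_derivative_along_line) (simp add: smooth_def)
  ultimately have der: "(\<psi> has_real_derivative (?D s - (?D 0 + L * s * (pnorm G h)\<^sup>2))) (at s)" for s
    unfolding \<psi>_def by (intro DERIV_diff)
  have neg: "?D s - (?D 0 + L * s * (pnorm G h)\<^sup>2) \<le> 0" if "s \<ge> 0" for s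
  proof -
    have "?D s - ?D 0 = (\<Sum>k\<in>params G. (grad f (?x s) - grad f (?x 0)) k * h k)"
      by (simp add: sum_subtractf algebra_simps)
    also have "\<dots> \<le> pnorm G (grad f (?x s) - grad f (?x 0)) * pnorm G h"
      by (rule inner_le_L2_set)
    also have "\<dots> \<le> (L * pnorm G (?x s - ?x 0)) * pnorm G h"
      using assms unfolding smooth_def by (intro mult_right_mono) auto
    also have "?x s - ?x 0 = (\<lambda>k. s * h k)" by auto
    finally show ?thesis
      using that by (simp add: L2_set_scale power2_eq_square mult_ac)
  qed
  have "\<psi> 1 \<le> \<psi> 0"
  proof (rule DERIV_nonpos_imp_nonincreasing[where f = \<psi>])
    show "\<exists>y. (\<psi> has_real_derivative y) (at s) \<and> y \<le> 0" if "0 \<le> s" "s \<le> 1" for s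
      using der neg[OF that(1)] by blast
  qed simp
  then show ?thesis by (simp add: \<psi>_def)
qed

text \<open>Every sampled neighbourhood lies in \<open>part_nodes G p\<close> and is empty at nodes
  outside it, so only finitely many maps remain although their domain is infinite.\<close>

lemma finite_samples:
  assumes "partitioned_graph G" "p \<in> {1..machines G}"
  shows "finite (samples G p)"
proof -
  have "part_nodes G p \<subseteq> nodes G" "finite (nodes G)"
    and E: "part_edges G p \<subseteq> part_nodes G p \<times> part_nodes G p"
    using assms unfolding partitioned_graph_def by blast+
  then have V: "finite (part_nodes G p)" by (blast intro: finite_subset)
  have "{m. \<forall>v. m v \<subseteq> neighbors (part_edges G p) v} \<subseteq>
      {m. \<forall>v. (v \<in> part_nodes G p \<longrightarrow> m v \<in> Pow (part_nodes G p)) \<and>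
        (v \<notin> part_nodes G p \<longrightarrow> m v = {})}"
    using E by (fastforce simp: neighbors_def)
  moreover have "finite \<dots>" using V by (intro finite_set_of_finite_funs) auto
  ultimately have "finite {m. \<forall>v. m v \<subseteq> neighbors (part_edges G p) v}"
    by (rule finite_subset)
  moreover have "finite (batches G p)"
    by (rule finite_subset[of _ "Pow (part_nodes G p)"]) (use V in \<open>auto simp: batches_def\<close>)
  ultimately show ?thesis unfolding samples_def by (intro finite_cartesian_product finite_PiE) auto
qed

text \<open>Passing through the gradient of \<open>full_loss G p\<close> splits the difference into
  the two discrepancies; squaring a sum of two terms costs the factor 2.\<close>

lemma local_global_discrepancy:
  assumes "partitioned_graph G" "finite_discrepancy G" "p \<in> {1..machines G}"
  shows "(pnorm G (grad (local_loss G p) \<theta> - grad (global_loss G) \<theta>))\<^sup>2 \<le> 2 * kappa_sq G"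
proof -
  let ?u = "grad (local_loss G p) \<theta>" and ?v = "grad (full_loss G p) \<theta>"
    and ?w = "grad (global_loss G) \<theta>"
  \<comment> \<open>Boundedness makes the supremum a genuine upper bound, and the maximum runs over
    finitely many machines.\<close>
  have upper: "D p \<theta> \<le> (MAX p\<in>{1..machines G}. SUP \<theta>. D p \<theta>)"
    if "bdd_above (range (D p))" for D :: "nat \<Rightarrow> weights \<Rightarrow> real"
    using cSUP_upper[OF UNIV_I that, of \<theta>] assms(3)
    by (intro order.trans[OF _ Max_ge]) auto
  have "discrepancy_A G p \<theta> \<le> (MAX p\<in>{1..machines G}. SUP \<theta>. discrepancy_A G p \<theta>)"
    "discrepancy_X G p \<theta> \<le> (MAX p\<in>{1..machines G}. SUP \<theta>. discrepancy_X G p \<theta>)"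
    by (intro upper; use assms in \<open>simp add: finite_discrepancy_def\<close>)+
  moreover have "(pnorm G (?u - ?w))\<^sup>2 \<le> 2 * (pnorm G (?u - ?v))\<^sup>2 + 2 * (pnorm G (?v - ?w))\<^sup>2"
  proof -
    have "(?u k - ?w k)\<^sup>2 \<le> 2 * (?u k - ?v k)\<^sup>2 + 2 * (?v k - ?w k)\<^sup>2" for k
      using sum_squares_bound[of "?u k - ?v k" "?v k - ?w k"]
      by (simp add: power2_eq_square algebra_simps)
    then show ?thesis
      by (simp add: L2_set_power2 sum_distrib_left sum_mono flip: sum.distrib)
  qed
  ultimately show ?thesis
    by (simp add: kappa_sq_def discrepancy_A_def discrepancy_X_def)
qed

section \<open>Parallel SGD with periodic averaging\<close>

text \<open>\<open>v\<close>, \<open>b\<close> and \<open>\<kappa>\<close> stand for the variance,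
  the squared bias and the squared discrepancy. The bound \<open>\<eta> * L \<le> 1\<close> lets a
  descent step absorb the squared norm of the mean gradient.\<close>

locale periodic_averaging =
  fixes G :: gcn and Q :: "nat \<Rightarrow> sample pmf" and \<theta>0 :: weights
    and L v b \<kappa> \<eta> :: real and T K :: nat
  assumes graph: "partitioned_graph G"
    and samples: "\<And>p. p \<in> {1..machines G} \<Longrightarrow> set_pmf (Q p) \<subseteq> samples G p"
    and L_pos: "L > 0"
    and smooth: "smooth G L (global_loss G)"
    and discrepancy: "\<And>p \<theta>. p \<in> {1..machines G} \<Longrightarrow>
      (pnorm G (grad (local_loss G p) \<theta> - grad (global_loss G) \<theta>))\<^sup>2 \<le> 2 * \<kappa>"
    and variance: "\<And>p \<theta>. p \<in> {1..machines G} \<Longrightarrow> measure_pmf.expectation (Q p)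
      (\<lambda>\<xi>. (pnorm G (sgrad_local G \<theta> \<xi> - mean_sgrad_local G (Q p) \<theta>))\<^sup>2) \<le> v"
    and bias: "\<And>p \<theta>. p \<in> {1..machines G} \<Longrightarrow>
      (pnorm G (mean_sgrad_local G (Q p) \<theta> - grad (local_loss G p) \<theta>))\<^sup>2 \<le> b"
    and \<eta>_nonneg: "\<eta> \<ge> 0"
    and \<eta>_le: "\<eta> * L \<le> 1"
    and K_pos: "K \<ge> 1"
begin

abbreviation P :: nat where "P \<equiv> machines G"
abbreviation x :: "(nat \<times> nat \<Rightarrow> sample) \<Rightarrow> nat \<Rightarrow> nat \<Rightarrow> weights" where
  "x \<equiv> local_params G \<theta>0 \<eta> K"
abbreviation xbar :: "(nat \<times> nat \<Rightarrow> sample) \<Rightarrow> nat \<Rightarrow> weights" where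
  "xbar \<equiv> avg_params G \<theta>0 \<eta> K"
abbreviation f :: "weights \<Rightarrow> real" where "f \<equiv> global_loss G"
abbreviation E :: "((nat \<times> nat \<Rightarrow> sample) \<Rightarrow> real) \<Rightarrow> real" where
  "E \<equiv> measure_pmf.expectation (draws G Q T)"

definition step_grad :: "(nat \<times> nat \<Rightarrow> sample) \<Rightarrow> nat \<Rightarrow> nat \<Rightarrow> weights" where
  "step_grad \<omega> t p = sgrad_local G (x \<omega> t p) (\<omega> (p, t))"

text \<open>Conditional mean of \<open>step_grad \<omega> t p\<close> given the earlier draws: these
  fix \<open>x \<omega> t p\<close>, and the draw at \<open>(p, t)\<close> is independent of
  them.\<close>

definition mean_grad :: "(nat \<times> nat \<Rightarrow> sample) \<Rightarrow> nat \<Rightarrow> nat \<Rightarrow> weights" where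
  "mean_grad \<omega> t p = mean_sgrad_local G (Q p) (x \<omega> t p)"

definition spread :: "(nat \<times> nat \<Rightarrow> sample) \<Rightarrow> nat \<Rightarrow> real" where
  "spread \<omega> t = 1 / real P * (\<Sum>p=1..P. (pnorm G (x \<omega> t p - xbar \<omega> t))\<^sup>2)"

section \<open>Pathwise dynamics of the local and averaged parameters\<close>

lemma P_pos: "P \<ge> 1"
  using graph by (simp add: partitioned_graph_def)

lemma finite_Q: "p \<in> {1..P} \<Longrightarrow> finite (set_pmf (Q p))"
  using samples finite_samples[OF graph] finite_subset by blast

lemma finite_draws: "finite (set_pmf (draws G Q T))"
  unfolding draws_def by (intro finite_set_Pi_pmf) (auto simp: finite_Q)

lemma integrable_draws [simp]: "integrable (measure_pmf (draws G Q T)) u" for u :: "_ \<Rightarrow> real"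
  by (rule integrable_measure_pmf_finite[OF finite_draws])

text \<open>Causality: a draw of step \<open>t\<close> first enters the parameters at time
  \<open>t + 1\<close>, so redrawing it leaves those at time \<open>t\<close> unchanged.\<close>

lemma local_params_cong:
  assumes "\<And>q s. s < t \<Longrightarrow> \<omega> (q, s) = \<omega>' (q, s)"
  shows "x \<omega> t p = x \<omega>' t p"
  using assms
proof (induction t arbitrary: p)
  case (Suc t)
  then have "x \<omega> t q = x \<omega>' t q" "\<omega> (q, t) = \<omega>' (q, t)" for q by auto
  then show ?case by (simp cong: if_cong)
qed simp

lemma avg_params_Suc:
  "xbar \<omega> (Suc t) = (\<lambda>k. xbar \<omega> t k + (- \<eta>) * (1 / real P * (\<Sum>p=1..P. step_grad \<omega> t p k)))"
proof
  fix k
  \<comment> \<open>Averaging preserves the mean, so both branches of the update give the same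
    recursion.\<close>
  have "xbar \<omega> (Suc t) k = 1 / real P * (\<Sum>p=1..P. x \<omega> t p k - \<eta> * step_grad \<omega> t p k)"
    using P_pos by (cases "K dvd Suc t") (simp_all add: avg_params_def step_grad_def Let_def)
  then show "xbar \<omega> (Suc t) k =
      xbar \<omega> t k + (- \<eta>) * (1 / real P * (\<Sum>p=1..P. step_grad \<omega> t p k))"
    by (simp add: avg_params_def sum_subtractf right_diff_distrib sum_distrib_left[symmetric])
qed

text \<open>\<open>t - t mod K\<close> is the latest synchronisation time up to \<open>t\<close>,
  with time 0 included. The deviation is zero there, and each later step adds
  \<open>- \<eta>\<close> times the difference between the machine's gradient and the mean
  gradient.\<close>

lemma local_deviation:
  assumes "p \<in> {1..P}"
  shows "x \<omega> t p k - xbar \<omega> t k = (- \<eta>) *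
    (\<Sum>s=t - t mod K..<t. step_grad \<omega> s p k - 1 / real P * (\<Sum>q=1..P. step_grad \<omega> s q k))"
proof (induction t)
  case 0
  then show ?case using P_pos by (simp add: avg_params_def)
next
  case (Suc t)
  show ?case
  proof (cases "K dvd Suc t")
    case True
    then have "x \<omega> (Suc t) p k = xbar \<omega> (Suc t) k"
      using P_pos by (simp add: avg_params_def Let_def)
    then show ?thesis using True by (simp add: mod_eq_0_iff_dvd)
  next
    case False
    \<comment> \<open>Without averaging the window keeps its left end and gains the index
      \<open>t\<close>.\<close>
    then have "Suc t mod K = Suc (t mod K)"
      using mod_Suc[of t K] by (auto simp: dvd_eq_mod_eq_0 split: if_splits)
    then have "{Suc t - Suc t mod K..<Suc t} = insert t {t - t mod K..<t}" by auto
    moreover have "x \<omega> (Suc t) p k = x \<omega> t p k - \<eta> * step_grad \<omega> t p k"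
      using False by (simp add: step_grad_def Let_def)
    ultimately show ?thesis
      using Suc by (simp add: avg_params_Suc algebra_simps del: local_params.simps)
  qed
qed

text \<open>The intermediate points are the local and the global gradient at
  \<open>x \<omega> t p\<close>; bias, discrepancy and smoothness of the global objective control
  the three differences.\<close>

lemma mean_grad_error:
  assumes "p \<in> {1..P}"
  shows "(pnorm G (mean_grad \<omega> t p - grad f \<theta>))\<^sup>2 \<le>
    3 * (L\<^sup>2 * (pnorm G (x \<omega> t p - \<theta>))\<^sup>2 + 2 * \<kappa> + b)"
proof -
  have "(pnorm G (grad f (x \<omega> t p) - grad f \<theta>))\<^sup>2 \<le> (L * pnorm G (x \<omega> t p - \<theta>))\<^sup>2"
    using smooth by (intro power_mono) (auto simp: smooth_def)
  then show ?thesis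
    using L2_set_power2_triangle3[of "mean_grad \<omega> t p" "grad f \<theta>" "params G"
        "grad (local_loss G p) (x \<omega> t p)" "grad f (x \<omega> t p)"]
      bias[OF assms, of "x \<omega> t p"] discrepancy[OF assms, of "x \<omega> t p"]
    by (simp add: mean_grad_def power_mult_distrib)
qed

lemma sum_mean_grad_error:
  "1 / real P * (\<Sum>p=1..P. (pnorm G (mean_grad \<omega> t p - grad f (xbar \<omega> t)))\<^sup>2) \<le>
    3 * (L\<^sup>2 * spread \<omega> t + 2 * \<kappa> + b)"
proof -
  have "(\<Sum>p=1..P. (pnorm G (mean_grad \<omega> t p - grad f (xbar \<omega> t)))\<^sup>2) \<le>
      (\<Sum>p=1..P. 3 * (L\<^sup>2 * (pnorm G (x \<omega> t p - xbar \<omega> t))\<^sup>2 + 2 * \<kappa> + b))"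
    by (intro sum_mono mean_grad_error)
  also have "\<dots> = 3 * (L\<^sup>2 * (\<Sum>p=1..P. (pnorm G (x \<omega> t p - xbar \<omega> t))\<^sup>2) + real P * (2 * \<kappa> + b))"
    by (simp add: sum.distrib algebra_simps flip: sum_distrib_left)
  finally show ?thesis
    using P_pos by (simp add: spread_def field_simps)
qed

subsection \<open>Fresh randomness in one step\<close>

text \<open>Joint law of the draws of step \<open>t\<close> alone. Integrating over it after
  overwriting these entries by \<open>redraw\<close> plays the role of conditional expectation given
  all other draws.\<close>

definition fresh :: "nat \<Rightarrow> (nat \<times> nat \<Rightarrow> sample) pmf" where
  "fresh t = Pi_pmf ({1..P} \<times> {t}) undefined (\<lambda>(p, t). Q p)"

definition redraw :: "nat \<Rightarrow> (nat \<times> nat \<Rightarrow> sample) \<Rightarrow> (nat \<times> nat \<Rightarrow> sample) \<Rightarrow> nat \<times> nat \<Rightarrow> sample"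
  where "redraw t \<omega> g = (\<lambda>i. if i \<in> {1..P} \<times> {t} then g i else \<omega> i)"

lemma finite_fresh: "finite (set_pmf (fresh t))"
  unfolding fresh_def by (intro finite_set_Pi_pmf) (auto simp: finite_Q)

lemma integrable_fresh [simp]: "integrable (measure_pmf (fresh t)) u" for u :: "_ \<Rightarrow> real"
  by (rule integrable_measure_pmf_finite[OF finite_fresh])

lemma expectation_redraw:
  assumes "t < T"
  shows "E u = E (\<lambda>\<omega>. measure_pmf.expectation (fresh t) (\<lambda>g. u (redraw t \<omega> g)))"
  unfolding draws_def fresh_def redraw_def
  by (rule expectation_Pi_pmf_resample) (use assms in \<open>auto simp: finite_Q\<close>)

text \<open>With \<open>\<omega>\<close> fixed, all positions at time \<open>t\<close> are frozen,
  and each machine's gradient becomes a function of its own fresh draw.\<close>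

lemma redraw_simps [simp]:
  "x (redraw t \<omega> g) t p = x \<omega> t p" "xbar (redraw t \<omega> g) t = xbar \<omega> t"
  "p \<in> {1..P} \<Longrightarrow> step_grad (redraw t \<omega> g) t p = sgrad_local G (x \<omega> t p) (g (p, t))"
proof -
  show x: "x (redraw t \<omega> g) t p = x \<omega> t p" for p
    by (rule local_params_cong) (simp add: redraw_def)
  show "xbar (redraw t \<omega> g) t = xbar \<omega> t"
    by (simp add: avg_params_def x)
  show "p \<in> {1..P} \<Longrightarrow> step_grad (redraw t \<omega> g) t p = sgrad_local G (x \<omega> t p) (g (p, t))"
    by (simp add: step_grad_def x) (simp add: redraw_def)
qed

lemma expectation_fresh_component:
  fixes u :: "sample \<Rightarrow> real"
  assumes "p \<in> {1..P}"
  shows "measure_pmf.expectation (fresh t) (\<lambda>g. u (g (p, t))) = measure_pmf.expectation (Q p) u"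
  unfolding fresh_def using assms by (subst expectation_Pi_pmf_component) auto

text \<open>Coordinatewise bias-variance decomposition with target \<open>y\<close>; the variance
  assumption bounds the part not involving \<open>y\<close>.\<close>

lemma sgrad_second_moment:
  assumes "p \<in> {1..P}"
  shows "measure_pmf.expectation (Q p) (\<lambda>\<xi>. (pnorm G (sgrad_local G \<theta> \<xi> - y))\<^sup>2) \<le>
    v + (pnorm G (mean_sgrad_local G (Q p) \<theta> - y))\<^sup>2"
proof -
  let ?m = "mean_sgrad_local G (Q p) \<theta>"
  note int = integrable_measure_pmf_finite[OF finite_Q[OF assms]]
  have coord: "measure_pmf.expectation (Q p) (\<lambda>\<xi>. (sgrad_local G \<theta> \<xi> k - y k)\<^sup>2) =
      (?m k - y k)\<^sup>2 + measure_pmf.expectation (Q p) (\<lambda>\<xi>. (sgrad_local G \<theta> \<xi> k - ?m k)\<^sup>2)" for k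
    using expectation_square_decomposition[OF finite_Q[OF assms],
        of "- y k" "\<lambda>\<xi>. sgrad_local G \<theta> \<xi> k"]
    by (simp add: mean_sgrad_local_def)
  have "measure_pmf.expectation (Q p) (\<lambda>\<xi>. (pnorm G (sgrad_local G \<theta> \<xi> - y))\<^sup>2) =
      (pnorm G (?m - y))\<^sup>2 +
      measure_pmf.expectation (Q p) (\<lambda>\<xi>. (pnorm G (sgrad_local G \<theta> \<xi> - ?m))\<^sup>2)"
    by (simp add: L2_set_power2 Bochner_Integration.integral_sum int coord sum.distrib)
  then show ?thesis using variance[OF assms, of \<theta>] by simp
qed

lemma expectation_step_grad:
  "measure_pmf.expectation (fresh t) (\<lambda>g. 1 / real P * (\<Sum>p=1..P. step_grad (redraw t \<omega> g) t p k)) =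
    1 / real P * (\<Sum>p=1..P. mean_grad \<omega> t p k)"
proof -
  have "measure_pmf.expectation (fresh t) (\<lambda>g. \<Sum>p=1..P. step_grad (redraw t \<omega> g) t p k) =
      (\<Sum>p=1..P. measure_pmf.expectation (fresh t) (\<lambda>g. sgrad_local G (x \<omega> t p) (g (p, t)) k))"
    by (simp add: Bochner_Integration.integral_sum)
  also have "\<dots> = (\<Sum>p=1..P. mean_grad \<omega> t p k)"
    unfolding mean_grad_def mean_sgrad_local_def
    by (intro sum.cong refl
        expectation_fresh_component[where u = "\<lambda>\<xi>. sgrad_local G (x \<omega> t _) \<xi> k"])
  finally show ?thesis by simp
qed

text \<open>By independence, \<open>P\<close> variances of at most \<open>v\<close>, each scaled by
  \<open>1 / P\<^sup>2\<close>, add up to at most \<open>v / P\<close>. This is the source of the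
  speed-up in the number of machines.\<close>

lemma step_grad_mean_second_moment:
  "measure_pmf.expectation (fresh t)
      (\<lambda>g. (pnorm G (\<lambda>k. 1 / real P * (\<Sum>p=1..P. step_grad (redraw t \<omega> g) t p k)))\<^sup>2) \<le>
    (pnorm G (\<lambda>k. 1 / real P * (\<Sum>p=1..P. mean_grad \<omega> t p k)))\<^sup>2 + v / real P"
proof -
  \<comment> \<open>The factor \<open>1 / P\<close> is put into each summand, so that the formula
    for squared sums applies with offset 0 and one independent summand per machine.\<close>
  define h where "h k i \<xi> = 1 / real P * sgrad_local G (x \<omega> t (fst i)) \<xi> k"
    for k and i :: "nat \<times> nat" and \<xi>
  have mean: "measure_pmf.expectation (Q p) (h k (p, t)) = 1 / real P * mean_grad \<omega> t p k" for p k
    by (simp add: h_def [abs_def] mean_grad_def mean_sgrad_local_def)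
  have I: "{1..P} \<times> {t} = (\<lambda>p. (p, t)) ` {1..P}" by auto
  have reindex: "(\<Sum>i\<in>{1..P} \<times> {t}. F i) = (\<Sum>p=1..P. F (p, t))" for F :: "_ \<Rightarrow> real"
    unfolding I by (subst sum.reindex) (auto simp: inj_on_def)
  have coord: "measure_pmf.expectation (fresh t)
      (\<lambda>g. (1 / real P * (\<Sum>p=1..P. step_grad (redraw t \<omega> g) t p k))\<^sup>2) =
    (1 / real P * (\<Sum>p=1..P. mean_grad \<omega> t p k))\<^sup>2 + (\<Sum>p=1..P. (1 / real P)\<^sup>2 *
      measure_pmf.expectation (Q p) (\<lambda>\<xi>. (sgrad_local G (x \<omega> t p) \<xi> k - mean_grad \<omega> t p k)\<^sup>2))"
    (is "?lhs = _") for k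
  proof -
    have "?lhs = measure_pmf.expectation (fresh t) (\<lambda>g. (0 + (\<Sum>i\<in>{1..P} \<times> {t}. h k i (g i)))\<^sup>2)"
      unfolding reindex by (simp add: h_def sum_distrib_left)
    also have "\<dots> = (0 + (\<Sum>p=1..P. 1 / real P * mean_grad \<omega> t p k))\<^sup>2 +
        (\<Sum>p=1..P. measure_pmf.expectation (Q p)
          (\<lambda>\<xi>. (h k (p, t) \<xi> - 1 / real P * mean_grad \<omega> t p k)\<^sup>2))"
      unfolding fresh_def
      by (subst expectation_square_sum_Pi_pmf)
        (simp_all only: reindex mean case_prod_conv, auto simp: finite_Q)
    finally show ?thesis
      by (simp only: h_def fst_conv right_diff_distrib[symmetric] power_mult_distrib
          sum_distrib_left[symmetric] integral_mult_right_zero add_0)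
  qed
  have "measure_pmf.expectation (fresh t)
      (\<lambda>g. (pnorm G (\<lambda>k. 1 / real P * (\<Sum>p=1..P. step_grad (redraw t \<omega> g) t p k)))\<^sup>2) =
    (\<Sum>k\<in>params G. measure_pmf.expectation (fresh t)
      (\<lambda>g. (1 / real P * (\<Sum>p=1..P. step_grad (redraw t \<omega> g) t p k))\<^sup>2))"
    unfolding L2_set_power2 by (intro Bochner_Integration.integral_sum integrable_fresh)
  also have "\<dots> = (pnorm G (\<lambda>k. 1 / real P * (\<Sum>p=1..P. mean_grad \<omega> t p k)))\<^sup>2 +
      (\<Sum>k\<in>params G. \<Sum>p=1..P. (1 / real P)\<^sup>2 *
        measure_pmf.expectation (Q p) (\<lambda>\<xi>. (sgrad_local G (x \<omega> t p) \<xi> k - mean_grad \<omega> t p k)\<^sup>2))"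
    unfolding coord L2_set_power2 by (rule sum.distrib)
  \<comment> \<open>Exchanging the sums reassembles coordinate variances into squared norms, to
    which the variance assumption applies.\<close>
  also have "(\<Sum>k\<in>params G. \<Sum>p=1..P. (1 / real P)\<^sup>2 *
        measure_pmf.expectation (Q p) (\<lambda>\<xi>. (sgrad_local G (x \<omega> t p) \<xi> k - mean_grad \<omega> t p k)\<^sup>2)) =
      (\<Sum>p=1..P. (1 / real P)\<^sup>2 * measure_pmf.expectation (Q p)
        (\<lambda>\<xi>. (pnorm G (sgrad_local G (x \<omega> t p) \<xi> - mean_grad \<omega> t p))\<^sup>2))"
    by (subst sum.swap) (auto intro!: sum.cong simp: L2_set_power2 sum_distrib_left
        Bochner_Integration.integral_sum integrable_measure_pmf_finite finite_Q)
  also have "\<dots> \<le> (\<Sum>p=1..P. (1 / real P)\<^sup>2 * v)"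
    unfolding mean_grad_def by (intro sum_mono mult_left_mono variance) auto
  also have "\<dots> = v / real P"
    using P_pos by (simp add: power2_eq_square field_simps)
  finally show ?thesis by simp
qed

subsection \<open>Consensus\<close>

text \<open>The gradients of the machines deviate least, in mean square, from their own average, so they
  may be compared with \<^term>\<open>grad f (xbar \<omega> s)\<close> instead.  This choice keeps
  \<^term>\<open>(pnorm G (grad f (xbar \<omega> s)))\<^sup>2\<close> out of the bound.\<close>

lemma spread_le:
  "spread \<omega> t \<le> \<eta>\<^sup>2 * real K * (\<Sum>s=t - t mod K..<t. 1 / real P *
    (\<Sum>p=1..P. (pnorm G (step_grad \<omega> s p - grad f (xbar \<omega> s)))\<^sup>2))"
proof -
  let ?I = "{t - t mod K..<t}"
  define a where "a s p k = step_grad \<omega> s p k - 1 / real P * (\<Sum>q=1..P. step_grad \<omega> s q k)" for s p k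
  have K: "real (card ?I) \<le> real K"
    using mod_less_divisor[of K t] K_pos by simp
  have coord: "(x \<omega> t p k - xbar \<omega> t k)\<^sup>2 \<le> \<eta>\<^sup>2 * real K * (\<Sum>s\<in>?I. (a s p k)\<^sup>2)"
    if "p \<in> {1..P}" for p k
  proof -
    \<comment> \<open>Cauchy-Schwarz in time; the window holds \<open>t mod K\<close> steps, fewer
      than \<open>K\<close>.\<close>
    have "(\<Sum>s\<in>?I. a s p k)\<^sup>2 \<le> (\<Sum>s\<in>?I. (a s p k)\<^sup>2) * real (card ?I)"
      by (rule sum_squared_le_sum_of_squares)
    also have "\<dots> \<le> (\<Sum>s\<in>?I. (a s p k)\<^sup>2) * real K"
      by (intro mult_left_mono K sum_nonneg) auto
    finally have "\<eta>\<^sup>2 * (\<Sum>s\<in>?I. a s p k)\<^sup>2 \<le> \<eta>\<^sup>2 * ((\<Sum>s\<in>?I. (a s p k)\<^sup>2) * real K)"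
      by (intro mult_left_mono) auto
    then show ?thesis
      unfolding local_deviation[OF that] by (simp add: a_def power_mult_distrib mult_ac)
  qed
  have "(\<Sum>p=1..P. (pnorm G (x \<omega> t p - xbar \<omega> t))\<^sup>2) \<le>
      (\<Sum>p=1..P. \<Sum>k\<in>params G. \<eta>\<^sup>2 * real K * (\<Sum>s\<in>?I. (a s p k)\<^sup>2))"
    unfolding L2_set_power2 by (intro sum_mono) (simp add: coord)
  also have "\<dots> = \<eta>\<^sup>2 * real K * (\<Sum>p=1..P. \<Sum>s\<in>?I. \<Sum>k\<in>params G. (a s p k)\<^sup>2)"
    by (simp add: sum.swap[of _ ?I] flip: sum_distrib_left)
  also have "(\<Sum>p=1..P. \<Sum>s\<in>?I. \<Sum>k\<in>params G. (a s p k)\<^sup>2) =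
      (\<Sum>s\<in>?I. \<Sum>k\<in>params G. \<Sum>p=1..P. (a s p k)\<^sup>2)"
    by (subst sum.swap) (intro sum.cong refl sum.swap)
  also have "\<eta>\<^sup>2 * real K * \<dots> \<le> \<eta>\<^sup>2 * real K * (\<Sum>s\<in>?I. \<Sum>k\<in>params G. \<Sum>p=1..P.
      (step_grad \<omega> s p k - grad f (xbar \<omega> s) k)\<^sup>2)"
  proof (rule mult_left_mono[OF sum_mono[OF sum_mono]])
    fix s k
    show "(\<Sum>p=1..P. (a s p k)\<^sup>2) \<le> (\<Sum>p=1..P. (step_grad \<omega> s p k - grad f (xbar \<omega> s) k)\<^sup>2)"
      using P_pos sum_square_deviation_le[of "{1..P}" "\<lambda>p. step_grad \<omega> s p k"]
      by (simp add: a_def)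
  qed auto
  also have "(\<Sum>s\<in>?I. \<Sum>k\<in>params G. \<Sum>p=1..P. (step_grad \<omega> s p k - grad f (xbar \<omega> s) k)\<^sup>2) =
      (\<Sum>s\<in>?I. \<Sum>p=1..P. (pnorm G (step_grad \<omega> s p - grad f (xbar \<omega> s)))\<^sup>2)"
    unfolding L2_set_power2 minus_apply by (intro sum.cong refl sum.swap)
  finally show ?thesis
    using P_pos by (simp add: spread_def fun_diff_def field_simps flip: sum_divide_distrib)
qed

text \<open>The comparison point \<open>grad f (xbar \<omega> t)\<close> is fixed while step
  \<open>t\<close> is redrawn. The noise contributes \<open>v\<close>, the mean gradients the rest,
  including the multiple of the spread that makes the consensus estimate recursive.\<close>

lemma expectation_step_grad_error:
  assumes "t < T"
  shows "E (\<lambda>\<omega>. 1 / real P * (\<Sum>p=1..P. (pnorm G (step_grad \<omega> t p - grad f (xbar \<omega> t)))\<^sup>2)) \<le>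
    v + 3 * (2 * \<kappa> + b) + 3 * L\<^sup>2 * E (\<lambda>\<omega>. spread \<omega> t)"
proof -
  have "measure_pmf.expectation (fresh t) (\<lambda>g. 1 / real P * (\<Sum>p=1..P.
      (pnorm G (step_grad (redraw t \<omega> g) t p - grad f (xbar (redraw t \<omega> g) t)))\<^sup>2)) \<le>
    v + 3 * (2 * \<kappa> + b) + 3 * L\<^sup>2 * spread \<omega> t" (is "?lhs \<le> _") for \<omega>
  proof -
    let ?y = "grad f (xbar \<omega> t)"
    have "?lhs = 1 / real P * (\<Sum>p=1..P. measure_pmf.expectation (fresh t)
        (\<lambda>g. (pnorm G (sgrad_local G (x \<omega> t p) (g (p, t)) - ?y))\<^sup>2))"
      by (simp add: Bochner_Integration.integral_sum)
    also have "\<dots> = 1 / real P * (\<Sum>p=1..P. measure_pmf.expectation (Q p)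
        (\<lambda>\<xi>. (pnorm G (sgrad_local G (x \<omega> t p) \<xi> - ?y))\<^sup>2))"
      by (intro arg_cong2[where f = "(*)"] refl sum.cong expectation_fresh_component[where
          u = "\<lambda>\<xi>. (pnorm G (sgrad_local G (x \<omega> t _) \<xi> - ?y))\<^sup>2"])
    also have "\<dots> \<le> 1 / real P * (\<Sum>p=1..P. v + (pnorm G (mean_grad \<omega> t p - ?y))\<^sup>2)"
      unfolding mean_grad_def by (intro mult_left_mono sum_mono sgrad_second_moment) auto
    also have "\<dots> = v + 1 / real P * (\<Sum>p=1..P. (pnorm G (mean_grad \<omega> t p - ?y))\<^sup>2)"
      using P_pos by (simp add: sum.distrib field_simps)
    finally show ?thesis using sum_mean_grad_error[of \<omega> t] by simp
  qed
  then have "E (\<lambda>\<omega>. 1 / real P * (\<Sum>p=1..P. (pnorm G (step_grad \<omega> t p - grad f (xbar \<omega> t)))\<^sup>2)) \<le>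
      E (\<lambda>\<omega>. v + 3 * (2 * \<kappa> + b) + 3 * L\<^sup>2 * spread \<omega> t)"
    unfolding expectation_redraw[OF assms, of "\<lambda>\<omega>. 1 / real P * _ \<omega>"]
    by (intro expectation_mono_finite finite_draws)
  then show ?thesis by simp
qed

text \<open>The constant 2 reproduces itself: by induction \<open>L\<^sup>2\<close> times each
  earlier expected spread is at most \<open>A / 16\<close>, so every error in the window is at most
  \<open>A + 3 * A / 16 \<le> 2 * A\<close>. The window length supplies the second factor
  \<open>K\<close>.\<close>

lemma expectation_spread_le:
  assumes "t < T" and small: "\<eta>\<^sup>2 * (real K)\<^sup>2 * L\<^sup>2 \<le> 1 / 32"
    and A: "A = v + 3 * (2 * \<kappa> + b)" "A \<ge> 0"
  shows "E (\<lambda>\<omega>. spread \<omega> t) \<le> 2 * (\<eta>\<^sup>2 * (real K)\<^sup>2 * A)"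
  using assms(1)
proof (induction t rule: less_induct)
  case (less t)
  let ?I = "{t - t mod K..<t}"
  let ?e = "\<lambda>\<omega> s. 1 / real P * (\<Sum>p=1..P. (pnorm G (step_grad \<omega> s p - grad f (xbar \<omega> s)))\<^sup>2)"
  have "E (\<lambda>\<omega>. spread \<omega> t) \<le> E (\<lambda>\<omega>. \<eta>\<^sup>2 * real K * (\<Sum>s\<in>?I. ?e \<omega> s))"
    by (intro expectation_mono_finite finite_draws spread_le)
  also have "\<dots> = \<eta>\<^sup>2 * real K * (\<Sum>s\<in>?I. E (\<lambda>\<omega>. ?e \<omega> s))"
    by (simp only: integral_mult_right_zero Bochner_Integration.integral_sum integrable_draws)
  also have "\<dots> \<le> \<eta>\<^sup>2 * real K * (\<Sum>s\<in>?I. 2 * A)"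
  proof (intro mult_left_mono sum_mono)
    fix s assume s: "s \<in> ?I"
    have "L\<^sup>2 * E (\<lambda>\<omega>. spread \<omega> s) \<le> L\<^sup>2 * (2 * (\<eta>\<^sup>2 * (real K)\<^sup>2 * A))"
      using less s by (intro mult_left_mono) auto
    also have "\<dots> = 2 * (\<eta>\<^sup>2 * (real K)\<^sup>2 * L\<^sup>2) * A" by (simp add: mult_ac)
    also have "\<dots> \<le> 2 * (1 / 32) * A"
      using small A(2) by (intro mult_right_mono mult_left_mono) auto
    finally show "E (\<lambda>\<omega>. ?e \<omega> s) \<le> 2 * A"
      using expectation_step_grad_error[of s] less.prems s A by simp
  qed auto
  also have "\<dots> = \<eta>\<^sup>2 * real K * (real (card ?I) * (2 * A))" by simp
  also have "\<dots> \<le> \<eta>\<^sup>2 * real K * (real K * (2 * A))"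
    using A(2) mod_less_divisor[of K t] K_pos by (intro mult_left_mono mult_right_mono) auto
  finally show ?case by (simp add: power2_eq_square mult_ac)
qed

subsection \<open>Descent\<close>

text \<open>Polarisation: twice the inner product is the sum of the squared norms minus the squared
  distance, which Jensen's inequality bounds by the average squared error of the machines.\<close>

lemma inner_mean_grad_lower:
  defines "m \<equiv> \<lambda>\<omega> t k. 1 / real P * (\<Sum>p=1..P. mean_grad \<omega> t p k)"
  shows "2 * (\<Sum>k\<in>params G. grad f (xbar \<omega> t) k * m \<omega> t k) \<ge>
    (pnorm G (grad f (xbar \<omega> t)))\<^sup>2 + (pnorm G (m \<omega> t))\<^sup>2 - 3 * (L\<^sup>2 * spread \<omega> t + 2 * \<kappa> + b)"
proof -
  let ?y = "grad f (xbar \<omega> t)"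
  have "m \<omega> t - ?y = (\<lambda>k. 1 / real (card {1..P}) * (\<Sum>p\<in>{1..P}. (mean_grad \<omega> t p - ?y) k))"
    using P_pos by (auto simp: m_def sum_subtractf field_simps)
  then have "(pnorm G (m \<omega> t - ?y))\<^sup>2 \<le> 1 / real P * (\<Sum>p=1..P. (pnorm G (mean_grad \<omega> t p - ?y))\<^sup>2)"
    using P_pos L2_set_power2_mean_le[of "{1..P}" "\<lambda>p. mean_grad \<omega> t p - ?y" "params G"] by simp
  also have "\<dots> \<le> 3 * (L\<^sup>2 * spread \<omega> t + 2 * \<kappa> + b)"
    by (rule sum_mean_grad_error)
  finally have "(pnorm G (m \<omega> t - ?y))\<^sup>2 \<le> 3 * (L\<^sup>2 * spread \<omega> t + 2 * \<kappa> + b)" .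
  moreover have "(pnorm G (m \<omega> t - ?y))\<^sup>2 = (pnorm G ?y)\<^sup>2 + (pnorm G (m \<omega> t))\<^sup>2
      - 2 * (\<Sum>k\<in>params G. ?y k * m \<omega> t k)"
    by (simp add: L2_set_power2 power2_diff sum.distrib sum_subtractf sum_distrib_left mult_ac)
  ultimately show ?thesis by simp
qed

text \<open>The descent inequality is averaged over the fresh draws only: its linear term sees the
  mean \<open>m\<close>, its quadratic term the second moment, whose noise part is at most
  \<open>v / P\<close>.\<close>

lemma expected_descent_step:
  "measure_pmf.expectation (fresh t) (\<lambda>g. f (xbar (redraw t \<omega> g) (Suc t))) \<le>
    f (xbar \<omega> t) - \<eta> / 2 * (pnorm G (grad f (xbar \<omega> t)))\<^sup>2
    + \<eta> / 2 * (3 * (L\<^sup>2 * spread \<omega> t + 2 * \<kappa> + b)) + L * \<eta>\<^sup>2 / 2 * (v / real P)"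
proof -
  let ?y = "grad f (xbar \<omega> t)"
  define u where "u g k = 1 / real P * (\<Sum>p=1..P. step_grad (redraw t \<omega> g) t p k)" for g k
  define m where "m k = 1 / real P * (\<Sum>p=1..P. mean_grad \<omega> t p k)" for k
  have Eu: "measure_pmf.expectation (fresh t) (\<lambda>g. u g k) = m k" for k
    unfolding u_def m_def by (rule expectation_step_grad)
  have Eu2: "measure_pmf.expectation (fresh t) (\<lambda>g. (pnorm G (u g))\<^sup>2) \<le> (pnorm G m)\<^sup>2 + v / real P"
    unfolding u_def m_def by (rule step_grad_mean_second_moment)
  have "f (xbar (redraw t \<omega> g) (Suc t)) \<le>
      f (xbar \<omega> t) + (- \<eta>) * (\<Sum>k\<in>params G. ?y k * u g k) + L * \<eta>\<^sup>2 / 2 * (pnorm G (u g))\<^sup>2" for g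
    using smooth_descent[OF smooth, of "xbar \<omega> t" "\<lambda>k. (- \<eta>) * u g k"]
    unfolding avg_params_Suc redraw_simps L2_set_scale u_def[symmetric]
    by (simp add: power_mult_distrib sum_distrib_left sum_negf mult_ac)
  then have "measure_pmf.expectation (fresh t) (\<lambda>g. f (xbar (redraw t \<omega> g) (Suc t))) \<le>
      measure_pmf.expectation (fresh t) (\<lambda>g. f (xbar \<omega> t) + (- \<eta>) * (\<Sum>k\<in>params G. ?y k * u g k)
        + L * \<eta>\<^sup>2 / 2 * (pnorm G (u g))\<^sup>2)"
    by (intro expectation_mono_finite finite_fresh)
  also have "\<dots> = f (xbar \<omega> t) + (- \<eta>) * (\<Sum>k\<in>params G. ?y k * m k) + L * \<eta>\<^sup>2 / 2 *
      measure_pmf.expectation (fresh t) (\<lambda>g. (pnorm G (u g))\<^sup>2)"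
    by (simp add: Bochner_Integration.integral_sum Eu)
  also have "\<dots> \<le> f (xbar \<omega> t) + (- \<eta>) * (\<Sum>k\<in>params G. ?y k * m k) + L * \<eta>\<^sup>2 / 2 *
      ((pnorm G m)\<^sup>2 + v / real P)"
    using Eu2 L_pos by (intro add_left_mono mult_left_mono) auto
  also have "\<dots> \<le> f (xbar \<omega> t) - \<eta> / 2 * ((pnorm G ?y)\<^sup>2 + (pnorm G m)\<^sup>2 -
      3 * (L\<^sup>2 * spread \<omega> t + 2 * \<kappa> + b)) + \<eta> / 2 * (pnorm G m)\<^sup>2 + L * \<eta>\<^sup>2 / 2 * (v / real P)"
  proof -
    have "\<eta> / 2 * ((pnorm G ?y)\<^sup>2 + (pnorm G m)\<^sup>2 - 3 * (L\<^sup>2 * spread \<omega> t + 2 * \<kappa> + b)) \<le>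
        \<eta> / 2 * (2 * (\<Sum>k\<in>params G. ?y k * m k))"
      using inner_mean_grad_lower[of \<omega> t] \<eta>_nonneg unfolding m_def[abs_def]
      by (intro mult_left_mono) auto
    \<comment> \<open>The quadratic term contributes at most \<open>\<eta> / 2\<close> times the
      squared norm of \<open>m\<close>, which cancels the same amount gained by
      polarisation.\<close>
    moreover have "\<eta> / 2 * (\<eta> * L) * (pnorm G m)\<^sup>2 \<le> \<eta> / 2 * 1 * (pnorm G m)\<^sup>2"
      using \<eta>_nonneg \<eta>_le by (intro mult_right_mono mult_left_mono) auto
    ultimately show ?thesis by (simp add: power2_eq_square distrib_left mult_ac)
  qed
  finally show ?thesis by (simp add: algebra_simps)
qed

lemma expected_descent:
  assumes "t < T"
  shows "\<eta> / 2 * E (\<lambda>\<omega>. (pnorm G (grad f (xbar \<omega> t)))\<^sup>2) \<le>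
    E (\<lambda>\<omega>. f (xbar \<omega> t)) - E (\<lambda>\<omega>. f (xbar \<omega> (Suc t)))
    + \<eta> / 2 * (3 * (L\<^sup>2 * E (\<lambda>\<omega>. spread \<omega> t) + 2 * \<kappa> + b)) + L * \<eta>\<^sup>2 / 2 * (v / real P)"
proof -
  have "E (\<lambda>\<omega>. f (xbar \<omega> (Suc t))) =
      E (\<lambda>\<omega>. measure_pmf.expectation (fresh t) (\<lambda>g. f (xbar (redraw t \<omega> g) (Suc t))))"
    by (rule expectation_redraw[OF assms])
  also have "\<dots> \<le> E (\<lambda>\<omega>. f (xbar \<omega> t) - \<eta> / 2 * (pnorm G (grad f (xbar \<omega> t)))\<^sup>2
    + \<eta> / 2 * (3 * (L\<^sup>2 * spread \<omega> t + 2 * \<kappa> + b)) + L * \<eta>\<^sup>2 / 2 * (v / real P))"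
    by (intro expectation_mono_finite finite_draws expected_descent_step)
  also have "\<dots> = E (\<lambda>\<omega>. f (xbar \<omega> t)) - \<eta> / 2 * E (\<lambda>\<omega>. (pnorm G (grad f (xbar \<omega> t)))\<^sup>2)
    + \<eta> / 2 * (3 * (L\<^sup>2 * E (\<lambda>\<omega>. spread \<omega> t) + 2 * \<kappa> + b)) + L * \<eta>\<^sup>2 / 2 * (v / real P)"
    by simp
  finally show ?thesis by simp
qed

text \<open>The expected objective values telescope, and the uniform spread bound gives the same
  remainder \<open>r\<close> in every step.\<close>

lemma sum_expected_gradient:
  assumes "bdd_below (range f)" and small: "\<eta>\<^sup>2 * (real K)\<^sup>2 * L\<^sup>2 \<le> 1 / 32"
    and A: "A = v + 3 * (2 * \<kappa> + b)" "A \<ge> 0"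
  shows "\<eta> / 2 * (\<Sum>t<T. E (\<lambda>\<omega>. (pnorm G (grad f (xbar \<omega> t)))\<^sup>2)) \<le>
    f \<theta>0 - (INF \<theta>. f \<theta>) + real T * (\<eta> / 2 * (3 * (2 * (\<eta>\<^sup>2 * (real K)\<^sup>2 * L\<^sup>2) * A + 2 * \<kappa> + b))
      + L * \<eta>\<^sup>2 / 2 * (v / real P))"
proof -
  let ?n = "\<lambda>t. E (\<lambda>\<omega>. (pnorm G (grad f (xbar \<omega> t)))\<^sup>2)" and ?F = "\<lambda>t. E (\<lambda>\<omega>. f (xbar \<omega> t))"
  define r where "r = \<eta> / 2 * (3 * (2 * (\<eta>\<^sup>2 * (real K)\<^sup>2 * L\<^sup>2) * A + 2 * \<kappa> + b))
      + L * \<eta>\<^sup>2 / 2 * (v / real P)"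
  have "\<eta> / 2 * ?n t \<le> ?F t - ?F (Suc t) + r" if "t < T" for t
  proof -
    have "L\<^sup>2 * E (\<lambda>\<omega>. spread \<omega> t) \<le> L\<^sup>2 * (2 * (\<eta>\<^sup>2 * (real K)\<^sup>2 * A))"
      by (intro mult_left_mono expectation_spread_le that small A) auto
    then have "\<eta> / 2 * (3 * (L\<^sup>2 * E (\<lambda>\<omega>. spread \<omega> t) + 2 * \<kappa> + b)) \<le>
        \<eta> / 2 * (3 * (2 * (\<eta>\<^sup>2 * (real K)\<^sup>2 * L\<^sup>2) * A + 2 * \<kappa> + b))"
      using \<eta>_nonneg by (intro mult_left_mono) (auto simp: mult_ac)
    then show ?thesis using expected_descent[OF that] by (simp add: r_def)
  qed
  then have "(\<Sum>t<T. \<eta> / 2 * ?n t) \<le> (\<Sum>t<T. ?F t - ?F (Suc t) + r)"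
    by (intro sum_mono) auto
  also have "\<dots> = ?F 0 - ?F T + real T * r"
    using sum_lessThan_telescope'[of ?F T] by (simp add: sum.distrib)
  also have "?F 0 = f \<theta>0"
  proof -
    have "xbar \<omega> 0 = \<theta>0" for \<omega> using P_pos by (auto simp: avg_params_def)
    then show ?thesis by simp
  qed
  finally have "(\<Sum>t<T. \<eta> / 2 * ?n t) \<le> f \<theta>0 - ?F T + real T * r" .
  \<comment> \<open>The infimum lies below the objective for every realisation, hence below its
    expectation.\<close>
  moreover have "?F T \<ge> (INF \<theta>. f \<theta>)"
    using expectation_mono_finite[OF finite_draws, of "\<lambda>_. INF \<theta>. f \<theta>" "\<lambda>\<omega>. f (xbar \<omega> T)"]
      cINF_lower[OF assms(1)] by simp
  ultimately show ?thesis by (simp add: sum_distrib_left r_def)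
qed

end

section \<open>The convergence rate\<close>

text \<open>The squared step size is \<open>P / T\<close>, and squaring the bound on
  \<open>K\<close> gives \<open>1 / 32\<close> as \<open>2 / 64\<close>. The surplus factor
  \<open>1 / sqrt (P * T)\<close> is what moves the spread into the decaying part of the
  error.\<close>

lemma step_size_bound:
  fixes P T :: nat and L :: real
  assumes "P \<ge> 1" "T \<ge> 1" "L > 0"
    and K: "real K \<le> sqrt 2 * real T powr (1/4) / (8 * L * real P powr (3/4))"
  shows "(sqrt (real P) / sqrt (real T))\<^sup>2 * (real K)\<^sup>2 * L\<^sup>2 \<le> 1 / (32 * sqrt (real P * real T))"
proof -
  have "(real T powr (1/4))\<^sup>2 = real T powr (1/2)"
    using assms by (simp add: powr_powr flip: powr_numeral)
  then have T: "(real T powr (1/4))\<^sup>2 = sqrt (real T)"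
    by (simp add: powr_half_sqrt)
  have "(real P powr (3/4))\<^sup>2 = real P powr (1 + 1/2)"
    using assms by (simp add: powr_powr flip: powr_numeral)
  also have "\<dots> = real P * sqrt (real P)"
    using assms by (simp only: powr_add) (simp add: powr_half_sqrt)
  finally have P: "(real P powr (3/4))\<^sup>2 = real P * sqrt (real P)" .
  have "(real K)\<^sup>2 \<le> (sqrt 2 * real T powr (1/4) / (8 * L * real P powr (3/4)))\<^sup>2"
    by (intro power_mono K) auto
  also have "\<dots> = sqrt (real T) / (32 * L\<^sup>2 * (real P * sqrt (real P)))"
    by (simp add: power_divide power_mult_distrib T P)
  finally have "(sqrt (real P) / sqrt (real T))\<^sup>2 * (real K)\<^sup>2 * L\<^sup>2 \<le>
      (sqrt (real P) / sqrt (real T))\<^sup>2 * (sqrt (real T) / (32 * L\<^sup>2 * (real P * sqrt (real P)))) * L\<^sup>2"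
    by (intro mult_right_mono mult_left_mono) auto
  also have "\<dots> = real P / (sqrt (real T) * sqrt (real T)) *
      (sqrt (real T) / (32 * L\<^sup>2 * (real P * sqrt (real P)))) * L\<^sup>2"
    using assms by (simp add: power_divide)
  also have "\<dots> = 1 / (32 * sqrt (real P * real T))"
    using assms by (simp add: real_sqrt_mult field_simps del: real_sqrt_mult_self)
  finally show ?thesis .
qed

theorem theorem1:
  shows "\<exists>(C :: real \<Rightarrow> real \<Rightarrow> real \<Rightarrow> real \<Rightarrow> real \<Rightarrow> real) (c :: real).
    \<forall>(G :: gcn) (Q :: nat \<Rightarrow> sample pmf) (R :: nat \<Rightarrow> nat set pmf) (\<theta>0 :: weights)
      (L :: real) (\<sigma>_var :: real) (\<sigma>_bias :: real) (\<sigma>_global :: real)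
      (\<eta> :: real) (T :: nat) (K :: nat).
      partitioned_graph G \<longrightarrow>
      (\<forall>p\<in>{1..machines G}. set_pmf (Q p) \<subseteq> samples G p \<and> set_pmf (R p) \<subseteq> batches G p) \<longrightarrow>
      L > 0 \<longrightarrow>
      smooth G L (global_loss G) \<longrightarrow>
      (\<forall>p\<in>{1..machines G}. smooth G L (local_loss G p)) \<longrightarrow>
      bdd_below (range (global_loss G)) \<longrightarrow>
      finite_discrepancy G \<longrightarrow>
      (\<forall>\<theta>. \<forall>p\<in>{1..machines G}.
         measure_pmf.expectation (Q p)
           (\<lambda>\<xi>. (pnorm G (sgrad_local G \<theta> \<xi> - mean_sgrad_local G (Q p) \<theta>))\<^sup>2) \<le> \<sigma>_var\<^sup>2 \<and>
         (pnorm G (mean_sgrad_local G (Q p) \<theta> - grad (local_loss G p) \<theta>))\<^sup>2 \<le> \<sigma>_bias\<^sup>2) \<longrightarrow>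
      (\<forall>\<theta>. \<forall>p\<in>{1..machines G}.
         measure_pmf.expectation (R p)
           (\<lambda>B. (pnorm G (sgrad_full G \<theta> B - grad (full_loss G p) \<theta>))\<^sup>2) \<le> \<sigma>_global\<^sup>2) \<longrightarrow>
      \<eta> = sqrt (real (machines G)) / sqrt (real T) \<longrightarrow>
      K \<ge> 1 \<longrightarrow>
      real K \<le> sqrt 2 * real T powr (1/4) / (8 * L * real (machines G) powr (3/4)) \<longrightarrow>
      real T \<ge> L\<^sup>2 * real (machines G) \<longrightarrow>
      1 / real T * (\<Sum>t<T. measure_pmf.expectation (draws G Q T)
          (\<lambda>\<omega>. (pnorm G (grad (global_loss G) (avg_params G \<theta>0 \<eta> K \<omega> t)))\<^sup>2))
        \<le> C L (global_loss G \<theta>0 - (INF \<theta>. global_loss G \<theta>))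
              (\<sigma>_var\<^sup>2) (\<sigma>_bias\<^sup>2) (kappa_sq G) / sqrt (real (machines G) * real T)
          + c * (kappa_sq G + \<sigma>_bias\<^sup>2)"
\<comment> \<open>After division by half of \<open>\<eta> * T\<close>, the initial gap gives
  \<open>2 * \<Delta>\<close>, the spread \<open>6 / 32 = 3 / 16\<close> times \<open>A\<close>, and
  the noise \<open>L * v\<close>. The residual \<open>3 * (2 * \<kappa> + b)\<close> is at most
  \<open>6 * (\<kappa> + b)\<close>.\<close>
proof (rule exI[of _ "\<lambda>L \<Delta> v b \<kappa>. 2 * \<Delta> + 3 / 16 * (v + 3 * (2 * \<kappa> + b)) + L * v"], rule exI[of _ 6],
    intro allI impI, goal_cases)
  case (1 G Q R \<theta>0 L \<sigma>_var \<sigma>_bias \<sigma>_global \<eta> T K)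
  let ?P = "machines G" and ?\<kappa> = "kappa_sq G" and ?v = "\<sigma>_var\<^sup>2" and ?b = "\<sigma>_bias\<^sup>2"
  have P: "?P \<ge> 1" using 1(1) by (simp add: partitioned_graph_def)
  have "0 < L\<^sup>2 * real ?P" using P 1(3) by simp
  then have "0 < real T" using 1(13) by linarith
  then have T: "T \<ge> 1" by simp
  \<comment> \<open>Square root of the lower bound on \<open>T\<close>; it is equivalent to
    \<open>\<eta> * L \<le> 1\<close>.\<close>
  have "L * sqrt (real ?P) \<le> sqrt (real T)"
    using real_sqrt_le_mono[OF 1(13)] 1(3) by (simp add: real_sqrt_mult)
  then have \<eta>L: "\<eta> * L \<le> 1" using T by (simp add: 1(10) field_simps)
  interpret periodic_averaging G Q \<theta>0 L ?v ?b ?\<kappa> \<eta> T K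
    by unfold_locales (use 1 \<eta>L local_global_discrepancy[OF 1(1) 1(7)] in auto)
  define q where "q = \<eta>\<^sup>2 * (real K)\<^sup>2 * L\<^sup>2"
  define s where "s = sqrt (real ?P * real T)"
  define S where "S = (\<Sum>t<T. E (\<lambda>\<omega>. (pnorm G (grad f (xbar \<omega> t)))\<^sup>2))"
  define \<Delta> where "\<Delta> = f \<theta>0 - (INF \<theta>. f \<theta>)"
  define A where "A = ?v + 3 * (2 * ?\<kappa> + ?b)"
  have "1 \<le> real ?P * real T" using P T by (simp add: mult_ge1_I)
  then have s: "s \<ge> 1" by (simp add: s_def)
  have q: "q \<le> 1 / (32 * s)"
    using step_size_bound[OF P T 1(3) 1(12)] by (simp add: q_def s_def 1(10))
  also have "\<dots> \<le> 1 / 32" using s by (simp add: field_simps)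
  finally have q32: "q \<le> 1 / 32" .
  \<comment> \<open>Machine 1 exists, and its squared gradient difference is a nonnegative lower
    bound.\<close>
  have "0 \<le> 2 * ?\<kappa>"
    using discrepancy[of 1] P by (intro order.trans[OF zero_le_power2]) auto
  then have \<kappa>: "?\<kappa> \<ge> 0" by simp
  then have A: "A \<ge> 0" by (simp add: A_def)
  have \<eta>: "\<eta> > 0" using P T by (simp add: 1(10))
  \<comment> \<open>The chosen \<open>\<eta>\<close> balances the two decaying terms:
    \<open>1 / (\<eta> * T)\<close> and \<open>\<eta> / P\<close> both equal
    \<open>1 / s\<close>.\<close>
  have \<eta>T: "\<eta> * real T = s"
    using T real_div_sqrt[of "real T"] by (simp add: 1(10) s_def real_sqrt_mult flip: times_divide_eq_right)
  have \<eta>P: "\<eta> / real ?P = 1 / s"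
    using P T by (simp add: 1(10) s_def real_sqrt_mult field_simps)
  have "\<eta> / 2 * S \<le> \<Delta> + real T * (\<eta> / 2 * (3 * (2 * q * A + 2 * ?\<kappa> + ?b)) +
      L * \<eta>\<^sup>2 / 2 * (?v / real ?P))"
    using sum_expected_gradient[OF 1(6) _ A_def A] q32 unfolding S_def \<Delta>_def q_def by simp
  then have "2 / (\<eta> * real T) * (\<eta> / 2 * S) \<le> 2 / (\<eta> * real T) *
      (\<Delta> + real T * (\<eta> / 2 * (3 * (2 * q * A + 2 * ?\<kappa> + ?b)) + L * \<eta>\<^sup>2 / 2 * (?v / real ?P)))"
    using \<eta> by (intro mult_left_mono) auto
  also have "2 / (\<eta> * real T) * (\<eta> / 2 * S) = 1 / real T * S"
    using \<eta> by simp
  also have "2 / (\<eta> * real T) * (\<Delta> + real T * (\<eta> / 2 * (3 * (2 * q * A + 2 * ?\<kappa> + ?b)) +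
      L * \<eta>\<^sup>2 / 2 * (?v / real ?P))) =
    2 * \<Delta> / (\<eta> * real T) + 3 * (2 * q * A + 2 * ?\<kappa> + ?b) + L * ?v * (\<eta> / real ?P)"
    using \<eta> T P by (simp add: field_simps power2_eq_square)
  also have "\<dots> = 2 * \<Delta> / s + 6 * (q * A) + (6 * ?\<kappa> + 3 * ?b) + L * ?v / s"
    unfolding \<eta>T \<eta>P by simp
  also have "\<dots> \<le> 2 * \<Delta> / s + 6 * (1 / (32 * s) * A) + 6 * (?\<kappa> + ?b) + L * ?v / s"
    using mult_right_mono[OF q A] zero_le_power2[of \<sigma>_bias] by (intro add_right_mono add_mono) auto
  also have "\<dots> = (2 * \<Delta> + 3 / 16 * A + L * ?v) / s + 6 * (?\<kappa> + ?b)"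
    by (simp add: add_divide_distrib)
  finally show ?case unfolding S_def s_def \<Delta>_def A_def .
qed

end
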